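(* Assume that $d'_i=d_i= d$ for all $i\in\mathbf Z$, where $d>0$ is a constant, and that $(f'_s(i,0))_{i\in\mathbf Z}$ is almost periodic with respect to $i$. Then for every $p\in\mathbf R$ $$\underline{\lambda_1}(p,-\infty)=\overline{\lambda_1}(p,-\infty)=\underline{\lambda_1^{-}}(p,-\infty)=\overline{\lambda_1^{-}}(p,-\infty).$$
   Context: A sequence $(e_i)_{i\in\mathbf Z}$ is almost periodic if for every sequence of integers $(i_n)_{n\ge1}$ there is a subsequence $(i_{n_k})$ such that $e_{i+i_{n_k}}$ converges uniformly in $i\in\mathbf Z$ as $k\to\infty$. Standing assumptions. The function $f:\mathbf Z\times[0,1]\to\mathbf R$ satisfies: $f(i,0)=f(i,1)=0$ for all $i$; $0<\inf_j f(j,s)\le f(i,s)\le f'_s(i,0)s$ for all $i\in\mathbf Z$ and $s\in(0,1)$; for some Hölder exponent $\gamma\in(0,1]$, $\sup_i\|f(i,\cdot)\|_{C^{1+\gamma}([0,1])}<\infty$; and $\liminf_{|i|\to\infty}\big(f'_s(i,0)-(\sqrt{d'_i}-\sqrt{d_i})^2\big)>0$ (with $d'_i=d_i=d$ this reads $\liminf_{|i|\to\infty}f'_s(i,0)>0$). Here $f'_s(i,0)$ is the derivative of $s\mapsto f(i,s)$ at $s=0$. Operators. For $\phi:\mathbf Z\to\mathbf R$ let $(\mathcal L\phi)_i=d'_i(\phi_{i+1}-\phi_i)+d_i(\phi_{i-1}-\phi_i)+f'_s(i,0)\phi_i$ and let the reflected operator be $(\mathcal L^-\phi)_i=d_{-i}(\phi_{i+1}-\phi_i)+d'_{-i}(\phi_{i-1}-\phi_i)+f'_s(-i,0)\phi_i$.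 For $p\in\mathbf R$ put $(L_p\phi)_i=e^{-pi}(\mathcal L(e^{p\cdot}\phi))_i$ and $(L^-_p\phi)_i=e^{-pi}(\mathcal L^-(e^{p\cdot}\phi))_i$, where $(e^{p\cdot}\phi)_j=e^{pj}\phi_j$. Generalized principal eigenvalues. $\mathcal A_{-\infty}$ is the set of $\phi:\mathbf Z\to\mathbf R$ with $\phi_i>0$ for all $i$, $\lim_{|i|\to\infty}\frac{\ln\phi_i}{i}=0$, and $\big(\frac{\phi_{i\pm1}-\phi_i}{\phi_i}\big)_{i\in\mathbf Z}$ bounded. Define $$\underline{\lambda_1}(p,-\infty)=\sup\{\lambda:\exists\phi\in\mathcal A_{-\infty},\ (L_p\phi)_i\ge\lambda\phi_i\ \forall i\in\mathbf Z\},\quad \overline{\lambda_1}(p,-\infty)=\inf\{\lambda:\exists\phi\in\mathcal A_{-\infty},\ (L_p\phi)_i\le\lambda\phi_i\ \forall i\in\mathbf Z\},$$ and $\underline{\lambda_1^-}(p,-\infty)$, $\overline{\lambda_1^-}(p,-\infty)$ by the same formulas with $L^-_p$ in place of $L_p$. *)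

theory Defs
  imports "HOL-Analysis.Analysis"
begin

text \<open>The filter of \<open>\<bar>i\<bar> \<rightarrow> \<infinity>\<close> on the integers, covering both ends.\<close>

definition abs_at_top :: "int filter" where
  "abs_at_top = filtercomap (\<lambda>i. \<bar>i\<bar>) at_top"

definition almost_periodic :: "(int \<Rightarrow> real) \<Rightarrow> bool" where
  "almost_periodic e \<longleftrightarrow>
    (\<forall>\<sigma> :: nat \<Rightarrow> int. \<exists>r :: nat \<Rightarrow> nat. strict_mono r \<and>
       uniformly_convergent_on UNIV (\<lambda>k i. e (i + \<sigma> (r k))))"

text \<open>The derivative of a function on \<open>[0,1]\<close>, one-sided at the endpoints, so that values
  outside \<open>[0,1]\<close> are irrelevant.\<close>

definition deriv01 :: "(real \<Rightarrow> real) \<Rightarrow> real \<Rightarrow> real" where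
  "deriv01 g s = vector_derivative g (at s within {0..1})"

definition slope0 :: "(int \<Rightarrow> real \<Rightarrow> real) \<Rightarrow> int \<Rightarrow> real" where
  "slope0 f i = deriv01 (f i) 0"

text \<open>The norm of \<open>C\<^sup>1\<^sup>+\<^sup>\<gamma>([0,1])\<close>, with value \<open>\<infinity>\<close> for functions outside the space; continuity
  of the derivative follows from finiteness of the Hoelder seminorm.\<close>

definition C1_Hoelder_norm :: "real \<Rightarrow> (real \<Rightarrow> real) \<Rightarrow> ereal" where
  "C1_Hoelder_norm \<gamma> g =
    (if g differentiable_on {0..1} then
       (SUP s\<in>{0..1}. ereal \<bar>g s\<bar>) + (SUP s\<in>{0..1}. ereal \<bar>deriv01 g s\<bar>) +
       (SUP (s, t)\<in>{(s, t). s \<in> {0..1} \<and> t \<in> {0..1} \<and> s \<noteq> t}.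
          ereal (\<bar>deriv01 g s - deriv01 g t\<bar> / \<bar>s - t\<bar> powr \<gamma>))
     else \<infinity>)"

text \<open>In the operators, the zeroth-order coefficient \<open>a\<close> is \<open>slope0 f\<close>, i.e. \<open>f'\<^sub>s(i,0)\<close>.\<close>

definition op_L :: "(int \<Rightarrow> real) \<Rightarrow> (int \<Rightarrow> real) \<Rightarrow> (int \<Rightarrow> real) \<Rightarrow> (int \<Rightarrow> real) \<Rightarrow> int \<Rightarrow> real" where
  "op_L d' d a \<phi> i = d' i * (\<phi> (i + 1) - \<phi> i) + d i * (\<phi> (i - 1) - \<phi> i) + a i * \<phi> i"

definition op_L_refl :: "(int \<Rightarrow> real) \<Rightarrow> (int \<Rightarrow> real) \<Rightarrow> (int \<Rightarrow> real) \<Rightarrow> (int \<Rightarrow> real) \<Rightarrow> int \<Rightarrow> real" where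
  "op_L_refl d' d a \<phi> i =
     d (- i) * (\<phi> (i + 1) - \<phi> i) + d' (- i) * (\<phi> (i - 1) - \<phi> i) + a (- i) * \<phi> i"

definition exp_conj :: "real \<Rightarrow> ((int \<Rightarrow> real) \<Rightarrow> int \<Rightarrow> real) \<Rightarrow> (int \<Rightarrow> real) \<Rightarrow> int \<Rightarrow> real" where
  "exp_conj p T \<phi> i = exp (- p * of_int i) * T (\<lambda>j. exp (p * of_int j) * \<phi> j) i"

definition admissible :: "(int \<Rightarrow> real) set" where
  "admissible = {\<phi>. (\<forall>i. \<phi> i > 0) \<and>
     ((\<lambda>i. ln (\<phi> i) / of_int i) \<longlongrightarrow> 0) abs_at_top \<and>
     bounded (range (\<lambda>i. (\<phi> (i + 1) - \<phi> i) / \<phi> i)) \<and>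
     bounded (range (\<lambda>i. (\<phi> (i - 1) - \<phi> i) / \<phi> i))}"

text \<open>Suprema and infima are taken in the extended reals, so that no convention about empty or
  unbounded sets of reals intervenes.\<close>

definition lower_eigenvalue :: "((int \<Rightarrow> real) \<Rightarrow> int \<Rightarrow> real) \<Rightarrow> ereal" where
  "lower_eigenvalue T = Sup (ereal ` {l. \<exists>\<phi>\<in>admissible. \<forall>i. T \<phi> i \<ge> l * \<phi> i})"

definition upper_eigenvalue :: "((int \<Rightarrow> real) \<Rightarrow> int \<Rightarrow> real) \<Rightarrow> ereal" where
  "upper_eigenvalue T = Inf (ereal ` {l. \<exists>\<phi>\<in>admissible. \<forall>i. T \<phi> i \<le> l * \<phi> i})"

end

theory Submission
  imports Defs
begin

text \<open>Up to a shift by a constant, the conjugated operator is a positive Jacobi operator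
  \<open>T\<phi>(i) = A \<phi>(i+1) + B \<phi>(i-1) + c(i) \<phi>(i)\<close> with \<open>c \<ge> 1\<close>. Almost periodicity and a Harnack inequality
  make the \<open>n\<close>-th root of \<open>T\<^sup>n 1\<close> asymptotically independent of the site, and partial Neumann sums
  then yield bounded sub- and supersolutions with arbitrarily close eigenvalues. A maximum principle
  shows that no admissible subsolution can beat an admissible supersolution. Finally, reflection turns
  \<open>T\<close> into its transpose, and summation by parts against bounded test functions shows that both
  have the same principal eigenvalue.\<close>

section \<open>Positive Jacobi operators\<close>

text \<open>As \<open>A\<close> and \<open>B\<close> do not depend on the site, the transpose is
  \<open>tri B A c\<close>; reflecting the site variable also exchanges \<open>A\<close> and
  \<open>B\<close>.\<close>

definition tri :: "real \<Rightarrow> real \<Rightarrow> (int \<Rightarrow> real) \<Rightarrow> (int \<Rightarrow> real) \<Rightarrow> int \<Rightarrow> real" where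
  "tri A B c \<phi> i = A * \<phi> (i + 1) + B * \<phi> (i - 1) + c i * \<phi> i"

text \<open>The constructed test functions lie in this class, on which the Wronskian stays
  bounded.\<close>

definition bounded_positive :: "(int \<Rightarrow> real) set" where
  "bounded_positive = {\<phi>. \<exists>m>0. \<exists>M. \<forall>i. m \<le> \<phi> i \<and> \<phi> i \<le> M}"

lemma tri_mono:
  assumes "A \<ge> 0" "B \<ge> 0" "\<And>i. c i \<ge> 0" "\<And>i. \<phi> i \<le> \<psi> i"
  shows "tri A B c \<phi> i \<le> tri A B c \<psi> i"
  unfolding tri_def using assms by (intro add_mono mult_left_mono) auto

lemma tri_scale: "tri A B c (\<lambda>i. k * \<phi> i) i = k * tri A B c \<phi> i"
  by (simp add: tri_def algebra_simps)

lemma tri_sum: "tri A B c (\<lambda>i. \<Sum>k\<in>I. \<phi> k i) i = (\<Sum>k\<in>I. tri A B c (\<phi> k) i)"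
  by (simp add: tri_def sum.distrib sum_distrib_left)

lemma tri_shift: "tri A B (\<lambda>i. c i + K) \<phi> i = tri A B c \<phi> i + K * \<phi> i"
  by (simp add: tri_def algebra_simps)

section \<open>Growth of admissible functions\<close>

lemma eventually_abs_at_top: "eventually P abs_at_top \<longleftrightarrow> (\<exists>N. \<forall>i. N \<le> \<bar>i\<bar> \<longrightarrow> P i)"
  unfolding abs_at_top_def eventually_filtercomap eventually_at_top_linorder by blast

lemma filterlim_real_abs_at_top: "filterlim (\<lambda>i. real_of_int \<bar>i\<bar>) at_top abs_at_top"
  unfolding abs_at_top_def
  by (rule filterlim_compose[OF filterlim_real_of_int_at_top filterlim_filtercomap])

lemma bounded_positive_admissible: "bounded_positive \<subseteq> admissible"
proof
  fix \<phi> assume "\<phi> \<in> bounded_positive"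
  then obtain m M where m: "m > 0" and b: "\<And>i. m \<le> \<phi> i" "\<And>i. \<phi> i \<le> M"
    by (auto simp: bounded_positive_def)
  have pos: "\<phi> i > 0" for i using m b(1)[of i] by linarith
  define C where "C = \<bar>ln m\<bar> + \<bar>ln M\<bar>"
  have ln: "\<bar>ln (\<phi> i)\<bar> \<le> C" for i
  proof -
    have "ln m \<le> ln (\<phi> i)" "ln (\<phi> i) \<le> ln M"
      using m b pos[of i] by (auto intro!: ln_mono less_le_trans[OF pos])
    then show ?thesis unfolding C_def by linarith
  qed
  have "((\<lambda>i. C / real_of_int \<bar>i\<bar>) \<longlongrightarrow> 0) abs_at_top"
    by (rule real_tendsto_divide_at_top[OF tendsto_const filterlim_real_abs_at_top])
  then have lim: "((\<lambda>i. ln (\<phi> i) / of_int i) \<longlongrightarrow> 0) abs_at_top"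
    by (rule Lim_null_comparison[rotated])
      (auto intro!: always_eventually divide_right_mono ln simp: abs_divide)
  have quot: "\<bar>(\<phi> j - \<phi> i) / \<phi> i\<bar> \<le> 2 * M / m" for i j
  proof -
    have "\<bar>\<phi> j - \<phi> i\<bar> \<le> 2 * M" using b(2)[of i] b(2)[of j] pos[of i] pos[of j] by linarith
    then show ?thesis unfolding abs_divide using b(1)[of i] m pos[of i]
      by (intro frac_le) auto
  qed
  show "\<phi> \<in> admissible"
    unfolding admissible_def using pos lim quot
    by (auto simp: bounded_iff intro!: exI[of _ "2 * M / m"])
qed

lemma admissible_subexponential:
  assumes "\<phi> \<in> admissible" "\<epsilon> > 0"
  shows "\<forall>\<^sub>F i in abs_at_top. exp (- \<epsilon> * \<bar>of_int i\<bar>) \<le> \<phi> i \<and> \<phi> i \<le> exp (\<epsilon> * \<bar>of_int i\<bar>)"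
proof -
  have pos: "\<phi> i > 0" for i using assms by (auto simp: admissible_def)
  have "((\<lambda>i. ln (\<phi> i) / of_int i) \<longlongrightarrow> 0) abs_at_top"
    using assms by (auto simp: admissible_def)
  then have "\<forall>\<^sub>F i in abs_at_top. \<bar>ln (\<phi> i) / of_int i\<bar> < \<epsilon>"
    using tendstoD[OF _ assms(2)] by fastforce
  \<comment> \<open>Away from zero the bound can be multiplied by \<open>\<bar>i\<bar>\<close>; at
    zero, division returns zero and carries no information.\<close>
  moreover have "\<forall>\<^sub>F i in abs_at_top. i \<noteq> 0"
    unfolding eventually_abs_at_top by (rule exI[of _ 1]) auto
  ultimately show ?thesis
  proof eventually_elim
    case (elim i)
    then have "\<bar>ln (\<phi> i)\<bar> \<le> \<epsilon> * \<bar>of_int i\<bar>" by (simp add: abs_divide field_simps)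
    then have "- \<epsilon> * \<bar>of_int i\<bar> \<le> ln (\<phi> i)" "ln (\<phi> i) \<le> \<epsilon> * \<bar>of_int i\<bar>" by linarith+
    then have "exp (- \<epsilon> * \<bar>of_int i\<bar>) \<le> exp (ln (\<phi> i))" "exp (ln (\<phi> i)) \<le> exp (\<epsilon> * \<bar>of_int i\<bar>)"
      unfolding exp_le_cancel_iff .
    then show ?case unfolding exp_ln[OF pos] by (rule conjI)
  qed
qed

section \<open>Comparison principles\<close>

text \<open>Maximum principle: the weight \<open>exp (\<epsilon> \<bar>i\<bar>)\<close> forces the quotient of \<open>\<phi>\<close> and
  \<open>\<psi> exp (\<epsilon> \<bar>i\<bar>)\<close> to attain its maximum, at the cost of a factor \<open>exp \<epsilon>\<close> in \<open>\<nu>\<close>.\<close>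

lemma comparison_nonneg:
  assumes AB: "A \<ge> 0" "B \<ge> 0" and c: "\<And>i. c i \<ge> 0"
    and adm: "\<phi> \<in> admissible" "\<psi> \<in> admissible"
    and sub: "\<And>i. tri A B c \<phi> i \<ge> \<mu> * \<phi> i" and super: "\<And>i. tri A B c \<psi> i \<le> \<nu> * \<psi> i"
  shows "\<mu> \<le> \<nu>"
proof -
  have pos: "\<phi> i > 0" "\<psi> i > 0" for i using adm by (auto simp: admissible_def)
  have main: "\<mu> \<le> exp \<epsilon> * \<nu>" if \<epsilon>: "\<epsilon> > 0" for \<epsilon>
  proof -
    define h :: "int \<Rightarrow> real" where "h i = exp (\<epsilon> * \<bar>of_int i\<bar>)" for i
    define g where "g i = \<phi> i / (\<psi> i * h i)" for i
    have hpos: "h i > 0" for i by (simp add: h_def)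
    have gpos: "g i > 0" for i using pos hpos by (simp add: g_def)
    have h_le: "h j \<le> exp \<epsilon> * h i" if "\<bar>j - i\<bar> \<le> 1" for i j
    proof -
      have "\<bar>real_of_int j\<bar> \<le> 1 + \<bar>of_int i\<bar>" using that by linarith
      then have "\<epsilon> * \<bar>real_of_int j\<bar> \<le> \<epsilon> * (1 + \<bar>of_int i\<bar>)" using \<epsilon> by (intro mult_left_mono) auto
      then show ?thesis by (simp add: h_def algebra_simps flip: exp_add)
    qed
    \<comment> \<open>The rate \<open>\<epsilon>/3\<close> is spent once on \<open>\<phi>\<close>
      and once on \<open>\<psi>\<close>, which leaves \<open>g i\<close> at most
      \<open>exp (- (\<epsilon>/3 * \<bar>i\<bar>))\<close> far out, hence below
      \<open>g 0\<close>.\<close>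
    have "filterlim (\<lambda>i::int. (\<epsilon>/3) * real_of_int \<bar>i\<bar>) at_top abs_at_top"
      by (rule filterlim_tendsto_pos_mult_at_top[OF tendsto_const _ filterlim_real_abs_at_top])
        (use \<epsilon> in auto)
    then have "\<forall>\<^sub>F i in abs_at_top. (\<epsilon>/3) * real_of_int \<bar>i\<bar> > - ln (g 0)"
      unfolding filterlim_at_top_dense by blast
    moreover have "\<epsilon>/3 > 0" using \<epsilon> by simp
    note admissible_subexponential[OF adm(1) this] admissible_subexponential[OF adm(2) this]
    ultimately have "\<forall>\<^sub>F i in abs_at_top. g i < g 0"
    proof eventually_elim
      case (elim i)
      have "g i \<le> exp (\<epsilon>/3 * \<bar>of_int i\<bar>) / (exp (- (\<epsilon>/3) * \<bar>of_int i\<bar>) * h i)"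
        unfolding g_def using elim pos hpos[of i] by (intro frac_le mult_right_mono) auto
      also have "\<dots> = exp (- (\<epsilon>/3 * \<bar>of_int i\<bar>))"
        by (simp add: h_def field_simps flip: exp_add)
      also have "\<dots> < exp (ln (g 0))" using elim by simp
      also have "\<dots> = g 0" using gpos by simp
      finally show ?case .
    qed
    then obtain N where N: "\<And>i. N \<le> \<bar>i\<bar> \<Longrightarrow> g i < g 0" by (auto simp: eventually_abs_at_top)
    have "{i. g 0 \<le> g i} \<subseteq> {-N..N}"
    proof
      fix i assume "i \<in> {i. g 0 \<le> g i}"
      then have "\<not> N \<le> \<bar>i\<bar>" using N[of i] by force
      then show "i \<in> {-N..N}" by auto
    qed
    then have fin: "finite {i. g 0 \<le> g i}" by (rule finite_subset) simp
    obtain j where j: "\<And>i. g i \<le> g j"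
    proof -
      have "Max (g ` {i. g 0 \<le> g i}) \<in> g ` {i. g 0 \<le> g i}" using fin by (intro Max_in) auto
      then obtain j where j: "g 0 \<le> g j" "Max (g ` {i. g 0 \<le> g i}) = g j" by auto
      have "g i \<le> g j" for i
      proof (cases "g 0 \<le> g i")
        case True
        then show ?thesis using fin by (auto simp flip: j(2) intro!: Max_ge)
      next
        case False
        then show ?thesis using j by linarith
      qed
      then show ?thesis using that by blast
    qed
    define k where "k = g j"
    \<comment> \<open>\<open>k * (\<psi> i * h i)\<close> lies above \<open>\<phi>\<close> and
      touches it at \<open>j\<close>, so the monotone operator, evaluated at \<open>j\<close>,
      transfers the supersolution bound to \<open>\<phi>\<close>.\<close>
    have le: "\<phi> i \<le> k * (\<psi> i * h i)" for i
      using j[of i] pos hpos by (simp add: g_def k_def pos_divide_le_eq)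
    have eq: "\<phi> j = k * (\<psi> j * h j)"
      using pos[of j] hpos[of j] by (simp add: g_def k_def)
    have kpos: "k > 0" using gpos by (simp add: k_def)
    have "\<mu> * \<phi> j \<le> tri A B c (\<lambda>i. k * (\<psi> i * h i)) j"
      by (rule order_trans[OF sub tri_mono[OF AB c le]])
    also have "\<dots> = k * tri A B c (\<lambda>i. \<psi> i * h i) j" by (rule tri_scale)
    also have "tri A B c (\<lambda>i. \<psi> i * h i) j
        \<le> A * (\<psi> (j + 1) * (exp \<epsilon> * h j)) + B * (\<psi> (j - 1) * (exp \<epsilon> * h j))
          + c j * (\<psi> j * (exp \<epsilon> * h j))"
      unfolding tri_def using AB c pos[THEN less_imp_le]
      by (intro add_mono mult_left_mono h_le) auto
    also have "\<dots> = exp \<epsilon> * h j * tri A B c \<psi> j" by (simp add: tri_def algebra_simps)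
    also have "\<dots> \<le> exp \<epsilon> * h j * (\<nu> * \<psi> j)" using super hpos[of j] by (intro mult_left_mono) auto
    finally have "\<mu> * \<phi> j \<le> (exp \<epsilon> * \<nu>) * \<phi> j"
      using kpos by (simp add: eq algebra_simps)
    then show ?thesis using pos(1)[of j] by simp
  qed
  have "((\<lambda>\<epsilon>. exp \<epsilon> * \<nu>) \<longlongrightarrow> exp 0 * \<nu>) (at_right 0)"
    by (intro tendsto_intros)
  moreover have "\<forall>\<^sub>F \<epsilon> in at_right 0. \<mu> \<le> exp \<epsilon> * \<nu>"
    using main by (auto simp: eventually_at_right_field intro: exI[of _ 1])
  ultimately show ?thesis
    by (intro tendsto_lowerbound[of "\<lambda>\<epsilon>. exp \<epsilon> * \<nu>" _ "at_right 0"]) auto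
qed

text \<open>Adding \<open>K\<close> to the coefficient makes it nonnegative and raises
  \<open>\<mu>\<close> and \<open>\<nu>\<close> by the same amount.\<close>

lemma comparison:
  assumes AB: "A \<ge> 0" "B \<ge> 0" and c: "\<And>i. c i \<ge> - K"
    and adm: "\<phi> \<in> admissible" "\<psi> \<in> admissible"
    and sub: "\<And>i. tri A B c \<phi> i \<ge> \<mu> * \<phi> i" and super: "\<And>i. tri A B c \<psi> i \<le> \<nu> * \<psi> i"
  shows "\<mu> \<le> \<nu>"
proof -
  have "\<mu> + K \<le> \<nu> + K"
  proof (rule comparison_nonneg[OF AB _ adm, of "\<lambda>i. c i + K"])
    show "c i + K \<ge> 0" for i using c[of i] by linarith
    show "(\<mu> + K) * \<phi> i \<le> tri A B (\<lambda>i. c i + K) \<phi> i"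
      "tri A B (\<lambda>i. c i + K) \<psi> i \<le> (\<nu> + K) * \<psi> i" for i
      using sub[of i] super[of i] unfolding tri_shift by (simp_all add: distrib_right)
  qed
  then show ?thesis by simp
qed

text \<open>Discrete Wronskian: \<open>\<phi> T\<psi> - \<psi> T*\<phi>\<close> telescopes, where \<open>T*\<close> is the
  transpose of \<open>T\<close>.\<close>

lemma transpose_comparison:
  assumes bp: "\<phi> \<in> bounded_positive" "\<psi> \<in> bounded_positive"
    and sub: "\<And>i. tri B A c \<phi> i \<ge> \<mu> * \<phi> i" and super: "\<And>i. tri A B c \<psi> i \<le> \<nu> * \<psi> i"
  shows "\<mu> \<le> \<nu>"
proof (rule ccontr)
  assume "\<not> \<mu> \<le> \<nu>"
  then have neg: "\<mu> - \<nu> > 0" by simp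
  obtain m M where m: "m > 0" "\<And>i. m \<le> \<phi> i" "\<And>i. \<phi> i \<le> M"
    using bp(1) by (auto simp: bounded_positive_def)
  obtain m' M' where m': "m' > 0" "\<And>i. m' \<le> \<psi> i" "\<And>i. \<psi> i \<le> M'"
    using bp(2) by (auto simp: bounded_positive_def)
  have pos: "\<phi> i > 0" "\<psi> i > 0" for i using m(1) m(2)[of i] m'(1) m'(2)[of i] by linarith+
  \<comment> \<open>Weighted flux across the bond from \<open>i - 1\<close> to \<open>i\<close>. It
    is bounded, yet \<open>\<mu> > \<nu>\<close> would lower it by a fixed positive amount at each
    step.\<close>
  define G where "G i = A * \<phi> (i - 1) * \<psi> i - B * \<psi> (i - 1) * \<phi> i" for i
  define R where "R = \<bar>A\<bar> * (M * M') + \<bar>B\<bar> * (M * M')"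
  have Gb: "\<bar>G i\<bar> \<le> R" for i
  proof -
    have prod: "\<bar>\<phi> j * \<psi> k\<bar> \<le> M * M'" for j k
      using pos[of j] pos[of k] m(3)[of j] m'(3)[of k] by (auto simp: abs_mult intro!: mult_mono)
    have "\<bar>G i\<bar> \<le> \<bar>A * (\<phi> (i - 1) * \<psi> i)\<bar> + \<bar>B * (\<phi> i * \<psi> (i - 1))\<bar>"
      unfolding G_def by (simp add: algebra_simps)
    also have "\<dots> \<le> R"
      unfolding R_def abs_mult[of A] abs_mult[of B] by (intro add_mono mult_left_mono prod) auto
    finally show ?thesis .
  qed
  have step: "G (i + 1) - G i \<le> - ((\<mu> - \<nu>) * (m * m'))" for i
  proof -
    have "G (i + 1) - G i = \<phi> i * tri A B c \<psi> i - \<psi> i * tri B A c \<phi> i"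
      by (simp add: G_def tri_def algebra_simps)
    also have "\<dots> \<le> \<phi> i * (\<nu> * \<psi> i) - \<psi> i * (\<mu> * \<phi> i)"
      using sub super pos[THEN less_imp_le] by (intro diff_mono mult_left_mono) auto
    also have "\<dots> = - ((\<mu> - \<nu>) * (\<phi> i * \<psi> i))" by (simp add: algebra_simps)
    also have "\<dots> \<le> - ((\<mu> - \<nu>) * (m * m'))"
      using neg m(1) m'(1) m(2)[of i] m'(2)[of i] by (simp add: mult_mono)
    finally show ?thesis .
  qed
  have tele: "G (int n) - G 0 \<le> - (real n * ((\<mu> - \<nu>) * (m * m')))" for n
  proof (induction n)
    case (Suc n)
    then show ?case using step[of "int n"] by (simp add: algebra_simps)
  qed simp
  have "(\<mu> - \<nu>) * (m * m') > 0" using neg m(1) m'(1) by simp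
  then obtain n where "2 * R < real n * ((\<mu> - \<nu>) * (m * m'))" using reals_Archimedean3 by blast
  then show False using tele[of n] Gb[of "int n"] Gb[of 0] by linarith
qed

section \<open>Almost periodic sequences\<close>

text \<open>The translates are totally bounded in the supremum norm: without a finite net, greedy
  selection yields translates pairwise more than \<open>\<delta>\<close> apart at some site, and no
  subsequence of them is uniformly Cauchy.\<close>

lemma almost_periodic_finite_net:
  assumes ap: "almost_periodic e" and \<delta>: "\<delta> > 0"
  shows "\<exists>F. finite F \<and> (\<forall>j. \<exists>k\<in>F. \<forall>i. \<bar>e (i + j) - e (i + k)\<bar> \<le> \<delta>)"
proof (rule ccontr)
  assume no: "\<not> ?thesis"
  define far where "far j k \<longleftrightarrow> (\<exists>i. \<bar>e (i + j) - e (i + k)\<bar> > \<delta>)" for j k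
  have "\<exists>j. \<forall>k\<in>F. far j k" if "finite F" for F
    using no that by (fastforce simp: far_def not_le)
  then have "\<exists>pick. \<forall>F. finite F \<longrightarrow> (\<forall>k\<in>F. far (pick F) k)" by metis
  then obtain pick where pick: "\<And>F k. finite F \<Longrightarrow> k \<in> F \<Longrightarrow> far (pick F) k" by blast
  \<comment> \<open>\<open>S n\<close> collects the first \<open>n\<close> picks; each new pick is
    far from all earlier ones.\<close>
  define S where "S = rec_nat {} (\<lambda>_ F. insert (pick F) F)"
  define \<sigma> where "\<sigma> n = pick (S n)" for n
  have S: "S 0 = {}" "S (Suc n) = insert (\<sigma> n) (S n)" for n by (simp_all add: S_def \<sigma>_def)
  have fin: "finite (S n)" for n by (induction n) (simp_all add: S)
  have mem: "m < n \<Longrightarrow> \<sigma> m \<in> S n" for m n by (induction n) (auto simp: S less_Suc_eq)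
  have far: "far (\<sigma> n) (\<sigma> m)" if "m < n" for m n
    unfolding \<sigma>_def[of n] by (rule pick[OF fin mem[OF that]])
  obtain r :: "nat \<Rightarrow> nat" where r: "strict_mono r"
    and "uniformly_convergent_on UNIV (\<lambda>k i. e (i + \<sigma> (r k)))"
    using ap unfolding almost_periodic_def by blast
  then have "uniformly_Cauchy_on UNIV (\<lambda>k i. e (i + \<sigma> (r k)))"
    by (metis uniformly_convergent_Cauchy)
  then obtain N where N: "\<And>i m n. m \<ge> N \<Longrightarrow> n \<ge> N \<Longrightarrow> dist (e (i + \<sigma> (r m))) (e (i + \<sigma> (r n))) < \<delta>"
    using \<delta> unfolding uniformly_Cauchy_on_def by blast
  have "r N < r (Suc N)" using r by (simp add: strict_mono_def)
  then obtain i where "\<bar>e (i + \<sigma> (r (Suc N))) - e (i + \<sigma> (r N))\<bar> > \<delta>"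
    using far unfolding far_def by blast
  then show False using N[of "Suc N" N i] by (simp add: dist_real_def)
qed

lemma almost_periodic_bounded:
  assumes "almost_periodic e"
  obtains K where "\<And>i. \<bar>e i\<bar> \<le> K"
proof -
  obtain F where F: "finite F" "\<And>j. \<exists>k\<in>F. \<forall>i. \<bar>e (i + j) - e (i + k)\<bar> \<le> 1"
    using almost_periodic_finite_net[OF assms zero_less_one] by blast
  have "\<bar>e j\<bar> \<le> (\<Sum>k\<in>F. \<bar>e k\<bar>) + 1" for j
  proof -
    obtain k where k: "k \<in> F" "\<And>i. \<bar>e (i + j) - e (i + k)\<bar> \<le> 1" using F(2) by blast
    have "\<bar>e k\<bar> \<le> (\<Sum>k\<in>F. \<bar>e k\<bar>)" by (rule member_le_sum) (use k F in auto)
    then show ?thesis using k(2)[of 0] by simp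
  qed
  then show ?thesis using that by blast
qed

lemma almost_periodic_add_const:
  assumes "almost_periodic e"
  shows "almost_periodic (\<lambda>i. e i + K)"
  unfolding almost_periodic_def
proof
  fix \<sigma> :: "nat \<Rightarrow> int"
  obtain r :: "nat \<Rightarrow> nat" where r: "strict_mono r"
    "uniformly_convergent_on UNIV (\<lambda>k i. e (i + \<sigma> (r k)))"
    using assms unfolding almost_periodic_def by blast
  then show "\<exists>r :: nat \<Rightarrow> nat. strict_mono r \<and> uniformly_convergent_on UNIV (\<lambda>k i. e (i + \<sigma> (r k)) + K)"
    by (intro exI[of _ r] conjI uniformly_convergent_add uniformly_convergent_on_const) auto
qed

text \<open>Translating the reflection by \<open>\<sigma>\<close> amounts to translating
  \<open>e\<close> by \<open>- \<sigma>\<close>, so the subsequence is extracted for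
  \<open>- \<sigma>\<close>.\<close>

lemma almost_periodic_reflect:
  assumes "almost_periodic e"
  shows "almost_periodic (\<lambda>i. e (- i))"
  unfolding almost_periodic_def
proof
  fix \<sigma> :: "nat \<Rightarrow> int"
  obtain r :: "nat \<Rightarrow> nat" and l where r: "strict_mono r"
    and l: "uniform_limit UNIV (\<lambda>k i. e (i + - \<sigma> (r k))) l sequentially"
    using assms[unfolded almost_periodic_def, rule_format, of "\<lambda>n. - \<sigma> n"]
    by (auto simp: uniformly_convergent_on_def)
  have "uniform_limit UNIV (\<lambda>k i. e (- (i + \<sigma> (r k)))) (\<lambda>i. l (- i)) sequentially"
    using uniform_limit_compose'[OF l, of uminus UNIV] by simp
  then show "\<exists>r :: nat \<Rightarrow> nat. strict_mono r \<and> uniformly_convergent_on UNIV (\<lambda>k i. e (- (i + \<sigma> (r k))))"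
    using r by (auto simp: uniformly_convergent_on_def)
qed

section \<open>Iterates of the operator on the constant 1\<close>

lemma tri_power_Suc:
  "(tri A B c ^^ Suc n) \<phi> i =
     A * (tri A B c ^^ n) \<phi> (i + 1) + B * (tri A B c ^^ n) \<phi> (i - 1) + c i * (tri A B c ^^ n) \<phi> i"
  by (simp add: tri_def[of A B c "(tri A B c ^^ n) \<phi>"])

lemma tri_power_pos:
  assumes "A > 0" "B > 0" "\<And>i. c i \<ge> 0"
  shows "(tri A B c ^^ n) (\<lambda>_. 1) i > 0"
proof (induction n arbitrary: i)
  case (Suc n)
  have "A * (tri A B c ^^ n) (\<lambda>_. 1) (i + 1) > 0" "B * (tri A B c ^^ n) (\<lambda>_. 1) (i - 1) > 0"
    "c i * (tri A B c ^^ n) (\<lambda>_. 1) i \<ge> 0"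
    using Suc assms by (simp_all add: less_imp_le)
  then show ?case unfolding tri_power_Suc by linarith
qed simp

lemma tri_power_Suc_le:
  assumes "A \<ge> 0" "B \<ge> 0" "\<And>i. c i \<ge> 0" "\<And>i. A + B + c i \<le> M"
  shows "(tri A B c ^^ Suc n) (\<lambda>_. 1) i \<le> M * (tri A B c ^^ n) (\<lambda>_. 1) i"
proof (induction n arbitrary: i)
  case 0
  then show ?case using assms(4)[of i] by (simp add: tri_def)
next
  case (Suc n)
  have "tri A B c ((tri A B c ^^ Suc n) (\<lambda>_. 1)) i
      \<le> tri A B c (\<lambda>i. M * (tri A B c ^^ n) (\<lambda>_. 1) i) i"
    by (rule tri_mono[OF assms(1-3) Suc])
  then show ?case by (simp only: tri_scale funpow.simps comp_apply)
qed

lemma tri_power_le: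
  assumes "A > 0" "B > 0" "\<And>i. c i \<ge> 0" "\<And>i. A + B + c i \<le> M"
  shows "(tri A B c ^^ n) (\<lambda>_. 1) i \<le> M ^ n"
proof (induction n)
  case (Suc n)
  have "M \<ge> 0" using assms(1,2) assms(3,4)[of 0] by linarith
  then show ?case
    using tri_power_Suc_le[of A B c M n i] assms Suc mult_left_mono[OF Suc, of M] by force
qed simp

text \<open>Harnack inequality, uniform in \<open>n\<close>: \<open>T\<^sup>n 1\<close> at \<open>i\<close> dominates a multiple of \<open>T\<^sup>n\<^sup>-\<^sup>1 1\<close> at the
  neighbours of \<open>i\<close>, and \<open>T\<^sup>n 1 \<le> M T\<^sup>n\<^sup>-\<^sup>1 1\<close>.\<close>

lemma tri_power_Harnack_step:
  assumes pos: "A > 0" "B > 0" and c: "\<And>i. c i \<ge> 0" and M: "\<And>i. A + B + c i \<le> M"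
    and C: "C \<ge> M / A" "C \<ge> M / B" and ij: "\<bar>j - i\<bar> = 1"
  shows "(tri A B c ^^ n) (\<lambda>_. 1) j \<le> C * (tri A B c ^^ n) (\<lambda>_. 1) i"
proof (cases n)
  case 0
  have "A \<le> M" using pos c[of 0] M[of 0] by linarith
  then have "1 \<le> M / A" using pos by simp
  then show ?thesis using C 0 by simp
next
  case (Suc k)
  define w where "w n = (tri A B c ^^ n) (\<lambda>_. 1)" for n
  have wpos: "w n i > 0" for n i unfolding w_def by (rule tri_power_pos[OF pos c])
  have Mpos: "M > 0" using pos c[of 0] M[of 0] by linarith
  have A0: "A * w k (i + 1) > 0" "B * w k (i - 1) > 0" "c i * w k i \<ge> 0"
    using pos c wpos by (simp_all add: less_imp_le)
  have wn: "w n i = A * w k (i + 1) + B * w k (i - 1) + c i * w k i"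
    unfolding w_def Suc by (rule tri_power_Suc)
  have "w n j \<le> M * w k j" unfolding w_def Suc
    by (rule tri_power_Suc_le) (use pos c M in auto)
  also have "\<dots> \<le> C * w n i"
  proof -
    consider "j = i + 1" | "j = i - 1" using ij by linarith
    then show ?thesis
    proof cases
      case 1
      have "M * w k j = M / A * (A * w k (i + 1))" using pos 1 by simp
      also have "\<dots> \<le> C * w n i"
        using C(1) A0 wn pos Mpos order_trans[OF _ C(1), of 0] by (intro mult_mono) auto
      finally show ?thesis .
    next
      case 2
      have "M * w k j = M / B * (B * w k (i - 1))" using pos 2 by simp
      also have "\<dots> \<le> C * w n i"
        using C(2) A0 wn pos Mpos order_trans[OF _ C(1), of 0] by (intro mult_mono) auto
      finally show ?thesis .
    qed
  qed
  finally show ?thesis by (simp add: w_def)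
qed

text \<open>The one-step bound is chained along the path from \<open>i\<close> to \<open>j\<close>;
  its constant depends neither on \<open>n\<close> nor on the sites.\<close>

lemma tri_power_Harnack:
  assumes pos: "A > 0" "B > 0" and c: "\<And>i. c i \<ge> 0" and M: "\<And>i. A + B + c i \<le> M"
  obtains C where "C \<ge> 1"
    "\<And>n i j. (tri A B c ^^ n) (\<lambda>_. 1) j \<le> C ^ nat \<bar>j - i\<bar> * (tri A B c ^^ n) (\<lambda>_. 1) i"
proof -
  define C where "C = max (M / A) (M / B)"
  have C: "C \<ge> M / A" "C \<ge> M / B" by (simp_all add: C_def)
  have "A \<le> M" using pos c[of 0] M[of 0] by linarith
  then have "1 \<le> M / A" using pos by simp
  then have C1: "C \<ge> 1" using C by linarith
  have "(tri A B c ^^ n) (\<lambda>_. 1) j \<le> C ^ k * (tri A B c ^^ n) (\<lambda>_. 1) i"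
    if "nat \<bar>j - i\<bar> = k" for n i j k
    using that
  proof (induction k arbitrary: j)
    case 0
    then show ?case by simp
  next
    case (Suc k)
    define j' where "j' = (if j > i then j - 1 else j + 1)"
    have j': "nat \<bar>j' - i\<bar> = k" "\<bar>j - j'\<bar> = 1" using Suc.prems by (auto simp: j'_def)
    have "(tri A B c ^^ n) (\<lambda>_. 1) j \<le> C * (tri A B c ^^ n) (\<lambda>_. 1) j'"
      by (rule tri_power_Harnack_step[OF pos c M C j'(2)])
    also have "\<dots> \<le> C * (C ^ k * (tri A B c ^^ n) (\<lambda>_. 1) i)"
      using Suc.IH[OF j'(1)] C1 by (intro mult_left_mono) auto
    finally show ?case by simp
  qed
  then show ?thesis using that C1 by blast
qed

text \<open>One factor \<open>s\<close> is lost per application: the diagonal term loses it by the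
  hypothesis on \<open>c\<close>, and the off-diagonal terms, which lose nothing, are enlarged using
  \<open>s \<ge> 1\<close>.\<close>

lemma tri_power_translate_le:
  assumes "A > 0" "B > 0" "\<And>i. c i \<ge> 0" "s \<ge> 1" "\<And>i. c (i + j) \<le> s * c (i + k)"
  shows "(tri A B c ^^ n) (\<lambda>_. 1) (i + j) \<le> s ^ n * (tri A B c ^^ n) (\<lambda>_. 1) (i + k)"
proof (induction n arbitrary: i)
  case (Suc n)
  define w where "w = (tri A B c ^^ n) (\<lambda>_. 1)"
  have wpos: "w i > 0" for i unfolding w_def using assms by (intro tri_power_pos) auto
  have IH: "w (i + j) \<le> s ^ n * w (i + k)" for i using Suc by (simp add: w_def)
  have IH': "w (i + j) \<le> s * (s ^ n * w (i + k))" for i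
  proof -
    have "s ^ n * w (i + k) \<ge> 0" using assms(4) wpos[of "i + k"] by simp
    from mult_right_mono[OF assms(4) this] show ?thesis using IH[of i] by linarith
  qed
  have "A * w (i + j + 1) + B * w (i + j - 1) + c (i + j) * w (i + j)
      \<le> A * (s * (s ^ n * w (i + k + 1))) + B * (s * (s ^ n * w (i + k - 1)))
        + (s * c (i + k)) * (s ^ n * w (i + k))"
    using assms IH'[of "i + 1"] IH'[of "i - 1"] IH[of i] wpos[of "i + j"]
    by (intro add_mono mult_left_mono mult_mono) (auto simp: algebra_simps)
  then show ?case unfolding tri_power_Suc w_def by (simp add: algebra_simps)
qed simp

text \<open>Here almost periodicity enters: the growth of \<open>T\<^sup>n 1\<close> is nearly independent of the site.
  Since \<open>c \<ge> 1\<close>, an additive error \<open>s - 1\<close> in \<open>c\<close> is a factor of at most \<open>s\<close>, so the finite net costs \<open>s\<^sup>n\<close>, and the Harnack constant of the net is absorbed by \<open>s\<^sup>n\<close>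
  for large \<open>n\<close>.\<close>

lemma tri_power_uniform_growth:
  assumes pos: "A > 0" "B > 0" and c: "\<And>i. c i \<ge> 1" and ap: "almost_periodic c" and s: "s > 1"
  shows "\<exists>n>0. \<exists>r>0. \<forall>i. (r / s\<^sup>2) ^ n \<le> (tri A B c ^^ n) (\<lambda>_. 1) i \<and>
    (tri A B c ^^ n) (\<lambda>_. 1) i \<le> (r * s\<^sup>2) ^ n"
proof -
  have c0: "\<And>i. c i \<ge> 0" using c order_trans zero_le_one by blast
  obtain K where K: "\<And>i. \<bar>c i\<bar> \<le> K" using almost_periodic_bounded[OF ap] by blast
  have M: "A + B + c i \<le> A + B + K" for i using K[of i] by simp
  obtain C where C1: "C \<ge> 1" and C: "\<And>n i j. (tri A B c ^^ n) (\<lambda>_. 1) j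
      \<le> C ^ nat \<bar>j - i\<bar> * (tri A B c ^^ n) (\<lambda>_. 1) i"
    by (rule tri_power_Harnack[where c = c, OF pos c0 M]) (rule that)
  obtain F where F: "finite F" "\<And>j. \<exists>k\<in>F. \<forall>i. \<bar>c (i + j) - c (i + k)\<bar> \<le> s - 1"
    using almost_periodic_finite_net[OF ap, of "s - 1"] s by auto
  define l where "l = (\<Sum>k\<in>F. nat \<bar>k\<bar>)"
  have l: "nat \<bar>k\<bar> \<le> l" if "k \<in> F" for k
    unfolding l_def by (rule member_le_sum) (use that F in auto)
  obtain n0 where n0: "C ^ l < s ^ n0" using real_arch_pow[OF s] by blast
  \<comment> \<open>The successor guarantees \<open>n > 0\<close>, which the \<open>n\<close>-th
    root below requires, and keeps \<open>C ^ l \<le> s ^ n\<close>.\<close>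
  define n where "n = Suc n0"
  have n: "C ^ l \<le> s ^ n" using n0 power_increasing[of n0 n s] s unfolding n_def by linarith
  define w where "w = (tri A B c ^^ n) (\<lambda>_. 1)"
  have wpos: "w i > 0" for i unfolding w_def by (rule tri_power_pos[OF pos c0])
  define r where "r = root n (w 0)"
  have n_pos: "n > 0" by (simp add: n_def)
  have rn: "r ^ n = w 0" "r > 0" using wpos[of 0] n_pos by (simp_all add: r_def)
  \<comment> \<open>One factor \<open>s ^ n\<close> moves from \<open>j\<close> to a net point
    \<open>k\<close>, the other absorbs the Harnack bound from \<open>k\<close> to 0.\<close>
  have "w j \<le> (s\<^sup>2) ^ n * w 0 \<and> w 0 \<le> (s\<^sup>2) ^ n * w j" for j
  proof -
    obtain k where k: "k \<in> F" "\<And>i. \<bar>c (i + j) - c (i + k)\<bar> \<le> s - 1" using F(2) by blast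
    have mult: "c (i + j) \<le> s * c (i + k)" "c (i + k) \<le> s * c (i + j)" for i
    proof -
      have "(s - 1) * 1 \<le> (s - 1) * c (i + k)" "(s - 1) * 1 \<le> (s - 1) * c (i + j)"
        using s c by (intro mult_left_mono; simp)+
      then show "c (i + j) \<le> s * c (i + k)" "c (i + k) \<le> s * c (i + j)"
        using k(2)[of i] by (simp_all add: algebra_simps abs_le_iff)
    qed
    have jk: "w j \<le> s ^ n * w k" "w k \<le> s ^ n * w j"
      using tri_power_translate_le[of A B c s j k n 0] tri_power_translate_le[of A B c s k j n 0]
        mult pos c0 s by (simp_all add: w_def)
    have CF: "C ^ nat \<bar>k\<bar> \<le> s ^ n" using power_increasing[OF l[OF k(1)] C1] n by linarith
    have "w k \<le> C ^ nat \<bar>k\<bar> * w 0" "w 0 \<le> C ^ nat \<bar>k\<bar> * w k"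
      using C[of n k 0] C[of n 0 k] by (simp_all add: w_def)
    then have k0: "w k \<le> s ^ n * w 0" "w 0 \<le> s ^ n * w k"
      using mult_right_mono[OF CF, of "w 0"] mult_right_mono[OF CF, of "w k"]
        wpos[of 0] wpos[of k] by linarith+
    have sq: "(s\<^sup>2) ^ n * x = s ^ n * (s ^ n * x)" for x
      by (simp add: power2_eq_square power_mult_distrib)
    have sn: "s ^ n \<ge> 0" using s by simp
    show ?thesis
      unfolding sq using order_trans[OF jk(1) mult_left_mono[OF k0(1) sn]]
        order_trans[OF k0(2) mult_left_mono[OF jk(2) sn]] by blast
  qed
  moreover have "(s\<^sup>2) ^ n > 0" using s by simp
  ultimately have "(r / s\<^sup>2) ^ n \<le> w j \<and> w j \<le> (r * s\<^sup>2) ^ n" for j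
    by (simp add: power_divide power_mult_distrib rn pos_divide_le_eq mult.commute)
  then show ?thesis
    using rn(2) by (intro exI[of _ n] exI[of _ r] conjI) (auto simp: n_pos w_def)
qed

section \<open>Sub- and supersolutions from truncated Neumann series\<close>

text \<open>The test function is the truncated Neumann series of the resolvent of \<open>T\<close> at \<open>\<mu>\<close>,
  for which \<open>T\<phi> - \<mu> \<phi>\<close> has the sign of \<open>T\<^sup>n 1 - \<mu>\<^sup>n\<close>.\<close>

lemma tri_test_function:
  assumes pos: "A > 0" "B > 0" and c: "\<And>i. c i \<ge> 0" and M: "\<And>i. A + B + c i \<le> M"
    and \<mu>: "\<mu> > 0" and n: "n > 0"
  obtains \<phi> where "\<phi> \<in> bounded_positive"
    "\<And>i. tri A B c \<phi> i - \<mu> * \<phi> i = \<mu> * ((tri A B c ^^ n) (\<lambda>_. 1) i / \<mu> ^ n - 1)"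
proof -
  define w where "w k = (tri A B c ^^ k) (\<lambda>_. 1)" for k
  define \<phi> where "\<phi> i = (\<Sum>k<n. 1 / \<mu> ^ k * w k i)" for i
  have wpos: "w k i > 0" for k i unfolding w_def by (rule tri_power_pos[OF pos c])
  have w0: "w 0 i = 1" for i by (simp add: w_def)
  \<comment> \<open>The term \<open>k = 0\<close> is identically 1; it belongs to the sum because
    \<open>n > 0\<close> and gives the lower bound.\<close>
  have "1 / \<mu> ^ 0 * w 0 i \<le> \<phi> i" for i unfolding \<phi>_def
    by (rule member_le_sum) (use n \<mu> wpos[THEN less_imp_le] in auto)
  then have "1 \<le> \<phi> i" for i by (simp add: w0)
  moreover have "\<phi> i \<le> (\<Sum>k<n. 1 / \<mu> ^ k * M ^ k)" for i
    unfolding \<phi>_def using \<mu> tri_power_le[OF pos c M]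
    by (intro sum_mono mult_left_mono) (auto simp: w_def)
  ultimately have bp: "\<phi> \<in> bounded_positive"
    unfolding bounded_positive_def using zero_less_one by blast
  have "tri A B c \<phi> i - \<mu> * \<phi> i = \<mu> * (w n i / \<mu> ^ n - 1)" for i
  proof -
    have "tri A B c \<phi> i = (\<Sum>k<n. 1 / \<mu> ^ k * w (Suc k) i)"
      unfolding \<phi>_def tri_sum tri_scale by (simp add: w_def)
    also have "\<dots> = (\<Sum>k<n. \<mu> * (w (Suc k) i / \<mu> ^ Suc k))" using \<mu> by (intro sum.cong) auto
    \<comment> \<open>Applying the operator shifts the index of the series, so subtracting
      \<open>\<mu> * \<phi> i\<close> leaves a telescoping sum.\<close>
    finally have "tri A B c \<phi> i - \<mu> * \<phi> i
        = \<mu> * (\<Sum>k<n. w (Suc k) i / \<mu> ^ Suc k - w k i / \<mu> ^ k)"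
      by (simp add: \<phi>_def sum_distrib_left sum_subtractf right_diff_distrib)
    then show ?thesis
      unfolding sum_lessThan_telescope[of "\<lambda>k. w k i / \<mu> ^ k"] by (simp add: w0)
  qed
  then show ?thesis using that bp by (simp add: w_def)
qed

text \<open>The two growth bounds serve as \<open>\<mu>\<close> in the test function: the lower one
  gives a subsolution, the upper one a supersolution.\<close>

lemma bounded_sub_supersolutions_ge_1:
  assumes pos: "A > 0" "B > 0" and c: "\<And>i. c i \<ge> 1" and ap: "almost_periodic c"
    and \<epsilon>: "\<epsilon> > 0"
  shows "\<exists>l u. \<exists>\<phi>\<in>bounded_positive. \<exists>\<psi>\<in>bounded_positive. u \<le> l + \<epsilon> \<and>
    (\<forall>i. tri A B c \<phi> i \<ge> l * \<phi> i) \<and> (\<forall>i. tri A B c \<psi> i \<le> u * \<psi> i)"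
proof -
  have c0: "\<And>i. c i \<ge> 0" using c order_trans zero_le_one by blast
  obtain K where K: "\<And>i. \<bar>c i\<bar> \<le> K" using almost_periodic_bounded[OF ap] by blast
  define M where "M = A + B + K"
  have M: "A + B + c i \<le> M" for i using K[of i] by (simp add: M_def)
  have Mpos: "M > 0" using M[of 0] c0[of 0] pos by linarith
  \<comment> \<open>The ratio of \<open>u = r * s\<^sup>2\<close> to
    \<open>l = r / s\<^sup>2\<close> is \<open>s ^ 4 = t\<close>, and \<open>l \<le> M\<close>, so
    \<open>u - l = l * (\<epsilon> / M)\<close> is at most \<open>\<epsilon>\<close>.\<close>
  define t where "t = 1 + \<epsilon> / M"
  have t: "t > 1" using Mpos \<epsilon> by (simp add: t_def)
  define s where "s = root 4 t"
  have s: "s > 1" "s ^ 4 = t" using t by (simp_all add: s_def)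
  obtain n r where n: "n > 0" and r: "r > 0"
    and lo_hi: "\<forall>i. (r / s\<^sup>2) ^ n \<le> (tri A B c ^^ n) (\<lambda>_. 1) i \<and>
      (tri A B c ^^ n) (\<lambda>_. 1) i \<le> (r * s\<^sup>2) ^ n"
    using tri_power_uniform_growth[OF pos c ap s(1)] by blast
  note lo = lo_hi[rule_format, THEN conjunct1] and hi = lo_hi[rule_format, THEN conjunct2]
  define l u where "l = r / s\<^sup>2" and "u = r * s\<^sup>2"
  have lu: "l > 0" "u > 0" using r s by (simp_all add: l_def u_def)
  obtain \<phi> where \<phi>: "\<phi> \<in> bounded_positive"
    "\<And>i. tri A B c \<phi> i - l * \<phi> i = l * ((tri A B c ^^ n) (\<lambda>_. 1) i / l ^ n - 1)"
    by (rule tri_test_function[where c = c, OF pos c0 M lu(1) n]) (rule that)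
  obtain \<psi> where \<psi>: "\<psi> \<in> bounded_positive"
    "\<And>i. tri A B c \<psi> i - u * \<psi> i = u * ((tri A B c ^^ n) (\<lambda>_. 1) i / u ^ n - 1)"
    by (rule tri_test_function[where c = c, OF pos c0 M lu(2) n]) (rule that)
  have "tri A B c \<phi> i \<ge> l * \<phi> i" for i
  proof -
    have "0 \<le> l * ((tri A B c ^^ n) (\<lambda>_. 1) i / l ^ n - 1)"
      using lo[of i] lu by (simp add: l_def[symmetric])
    then show ?thesis using \<phi>(2)[of i] by linarith
  qed
  moreover have "tri A B c \<psi> i \<le> u * \<psi> i" for i
  proof -
    have "l * 0 \<le> u * (1 - (tri A B c ^^ n) (\<lambda>_. 1) i / u ^ n)"
      using hi[of i] lu by (simp add: u_def[symmetric])
    then show ?thesis using \<psi>(2)[of i] by (simp add: algebra_simps)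
  qed
  moreover have "u \<le> l + \<epsilon>"
  proof -
    have "l ^ n \<le> M ^ n"
      using lo[of 0] tri_power_le[where c = c and i = 0, OF pos c0 M, of n] by (simp add: l_def)
    then have "l \<le> M" using lu Mpos n by (simp add: power_mono_iff)
    then have "l * (\<epsilon> / M) \<le> M * (\<epsilon> / M)" using \<epsilon> Mpos by (intro mult_right_mono) auto
    moreover have "u = t * l"
      unfolding u_def l_def s(2)[symmetric] using s(1)
      by (simp add: power2_eq_square power4_eq_xxxx)
    ultimately show ?thesis using Mpos by (simp add: t_def algebra_simps)
  qed
  ultimately show ?thesis using \<phi>(1) \<psi>(1) by blast
qed

text \<open>Adding \<open>K + 1\<close>, with \<open>K\<close> a bound for \<open>c\<close>, makes
  the coefficient at least 1; subtracting it from \<open>l\<close> and \<open>u\<close> preserves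
  their gap.\<close>

lemma bounded_sub_supersolutions:
  assumes pos: "A > 0" "B > 0" and ap: "almost_periodic c" and \<epsilon>: "\<epsilon> > 0"
  obtains l u \<phi> \<psi> where "\<phi> \<in> bounded_positive" "\<psi> \<in> bounded_positive" "u \<le> l + \<epsilon>"
    "\<And>i. tri A B c \<phi> i \<ge> l * \<phi> i" "\<And>i. tri A B c \<psi> i \<le> u * \<psi> i"
proof -
  obtain K where K: "\<And>i. \<bar>c i\<bar> \<le> K" using almost_periodic_bounded[OF ap] by blast
  have "c i + (K + 1) \<ge> 1" for i using K[of i] by linarith
  from bounded_sub_supersolutions_ge_1[OF pos this almost_periodic_add_const[OF ap] \<epsilon>]
  obtain l u \<phi> \<psi> where "\<phi> \<in> bounded_positive" "\<psi> \<in> bounded_positive" "u \<le> l + \<epsilon>"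
    "\<And>i. tri A B c \<phi> i + (K + 1) * \<phi> i \<ge> l * \<phi> i"
    "\<And>i. tri A B c \<psi> i + (K + 1) * \<psi> i \<le> u * \<psi> i"
    unfolding tri_shift by blast
  then show ?thesis
    by (intro that[of \<phi> \<psi> "u - (K + 1)" "l - (K + 1)"]) (auto simp: left_diff_distrib diff_le_eq le_diff_eq)
qed

section \<open>Equality of the principal eigenvalues\<close>

lemma eigenvalues_between:
  assumes "\<phi> \<in> bounded_positive" "\<psi> \<in> bounded_positive"
    "\<And>i. T \<phi> i \<ge> l * \<phi> i" "\<And>i. T \<psi> i \<le> u * \<psi> i"
  shows "ereal l \<le> lower_eigenvalue T" "upper_eigenvalue T \<le> ereal u"
proof -
  have "\<phi> \<in> admissible" "\<psi> \<in> admissible" using assms bounded_positive_admissible by blast+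
  then have "l \<in> {l. \<exists>\<phi>\<in>admissible. \<forall>i. T \<phi> i \<ge> l * \<phi> i}"
    "u \<in> {u. \<exists>\<psi>\<in>admissible. \<forall>i. T \<psi> i \<le> u * \<psi> i}"
    using assms(3,4) by blast+
  then show "ereal l \<le> lower_eigenvalue T" "upper_eigenvalue T \<le> ereal u"
    unfolding lower_eigenvalue_def upper_eigenvalue_def
    by (blast intro: Sup_upper Inf_lower)+
qed

lemma lower_le_upper_eigenvalue:
  assumes "A > 0" "B > 0" "almost_periodic c"
  shows "lower_eigenvalue (tri A B c) \<le> upper_eigenvalue (tri A B c)"
proof -
  obtain K where K: "\<And>i. \<bar>c i\<bar> \<le> K" using almost_periodic_bounded[OF assms(3)] by blast
  have "- K \<le> c i" for i using K[of i] by linarith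
  then have le: "\<mu> \<le> \<nu>" if "\<phi> \<in> admissible" "\<psi> \<in> admissible"
    "\<forall>i. tri A B c \<phi> i \<ge> \<mu> * \<phi> i" "\<forall>i. tri A B c \<psi> i \<le> \<nu> * \<psi> i" for \<phi> \<psi> \<mu> \<nu>
    using comparison[of A B K c \<phi> \<psi> \<mu> \<nu>] that assms by auto
  show ?thesis
    unfolding lower_eigenvalue_def upper_eigenvalue_def
  proof (intro Sup_least Inf_greatest, elim imageE CollectE bexE)
    fix x y \<mu> \<nu> \<phi> \<psi>
    assume *: "x = ereal \<mu>" "\<phi> \<in> admissible" "\<forall>i. tri A B c \<phi> i \<ge> \<mu> * \<phi> i"
      "y = ereal \<nu>" "\<psi> \<in> admissible" "\<forall>i. tri A B c \<psi> i \<le> \<nu> * \<psi> i"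
    show "x \<le> y" using le[OF *(2,5,3,6)] unfolding *(1,4) by simp
  qed
qed

text \<open>Explicit sub- and supersolutions bring the two eigenvalues within every
  \<open>\<epsilon>\<close>; the comparison principle gives the opposite inequality.\<close>

lemma lower_eq_upper_eigenvalue:
  assumes "A > 0" "B > 0" "almost_periodic c"
  shows "lower_eigenvalue (tri A B c) = upper_eigenvalue (tri A B c)"
proof (rule antisym[OF lower_le_upper_eigenvalue[OF assms]], rule ereal_le_epsilon2)
  fix \<epsilon> :: real assume \<epsilon>: "\<epsilon> > 0"
  obtain l u \<phi> \<psi> where *: "\<phi> \<in> bounded_positive" "\<psi> \<in> bounded_positive" "u \<le> l + \<epsilon>"
    "\<And>i. tri A B c \<phi> i \<ge> l * \<phi> i" "\<And>i. tri A B c \<psi> i \<le> u * \<psi> i"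
    by (rule bounded_sub_supersolutions[OF assms \<epsilon>]) (rule that)
  note b = eigenvalues_between[of \<phi> \<psi> l "tri A B c" u, OF *(1,2,4,5)]
  have "upper_eigenvalue (tri A B c) \<le> ereal u" by (rule b)
  also have "\<dots> \<le> ereal l + ereal \<epsilon>" using *(3) by simp
  also have "\<dots> \<le> lower_eigenvalue (tri A B c) + ereal \<epsilon>" by (intro add_right_mono b)
  finally show "upper_eigenvalue (tri A B c) \<le> lower_eigenvalue (tri A B c) + ereal \<epsilon>" .
qed

text \<open>Undoing the reflection turns a subsolution for the reflected coefficient into one for
  the transpose, so the Wronskian gives \<open>l' \<le> u\<close>. Then \<open>u' \<le> l' +
  \<epsilon>/2 \<le> u + \<epsilon>/2 \<le> l + \<epsilon>\<close>.\<close>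

lemma upper_le_lower_eigenvalue_reflect:
  assumes "A > 0" "B > 0" "almost_periodic c"
  shows "upper_eigenvalue (tri A B (\<lambda>i. c (- i))) \<le> lower_eigenvalue (tri A B c)"
proof (rule ereal_le_epsilon2)
  fix \<epsilon> :: real assume "\<epsilon> > 0"
  then have \<epsilon>: "\<epsilon> / 2 > 0" by simp
  obtain l u \<phi> \<psi> where *: "\<phi> \<in> bounded_positive" "\<psi> \<in> bounded_positive" "u \<le> l + \<epsilon> / 2"
    "\<And>i. tri A B c \<phi> i \<ge> l * \<phi> i" "\<And>i. tri A B c \<psi> i \<le> u * \<psi> i"
    by (rule bounded_sub_supersolutions[OF assms \<epsilon>]) (rule that)
  obtain l' u' \<phi>' \<psi>' where **: "\<phi>' \<in> bounded_positive" "\<psi>' \<in> bounded_positive" "u' \<le> l' + \<epsilon> / 2"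
    "\<And>i. tri A B (\<lambda>i. c (- i)) \<phi>' i \<ge> l' * \<phi>' i" "\<And>i. tri A B (\<lambda>i. c (- i)) \<psi>' i \<le> u' * \<psi>' i"
    by (rule bounded_sub_supersolutions[OF assms(1,2) almost_periodic_reflect[OF assms(3)] \<epsilon>]) (rule that)
  have "l' \<le> u"
  proof (rule transpose_comparison[OF _ *(2), of "\<lambda>i. \<phi>' (- i)"])
    show "(\<lambda>i. \<phi>' (- i)) \<in> bounded_positive" using **(1) unfolding bounded_positive_def by blast
    show "l' * \<phi>' (- i) \<le> tri B A c (\<lambda>i. \<phi>' (- i)) i" for i
    proof -
      have "\<phi>' (- 1 - i) = \<phi>' (- i - 1)" by (rule arg_cong[of _ _ \<phi>']) simp
      then show ?thesis using **(4)[of "- i"] by (simp add: tri_def add.commute)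
    qed
  qed (rule *(5))
  note b = eigenvalues_between[of \<phi> \<psi> l "tri A B c" u, OF *(1,2,4,5)]
    eigenvalues_between[of \<phi>' \<psi>' l' "tri A B (\<lambda>i. c (- i))" u', OF **(1,2,4,5)]
  have "upper_eigenvalue (tri A B (\<lambda>i. c (- i))) \<le> ereal u'" by (rule b)
  also have "\<dots> \<le> ereal l + ereal \<epsilon>" using *(3) **(3) \<open>l' \<le> u\<close> by simp
  also have "\<dots> \<le> lower_eigenvalue (tri A B c) + ereal \<epsilon>" by (intro add_right_mono b)
  finally show "upper_eigenvalue (tri A B (\<lambda>i. c (- i)))
      \<le> lower_eigenvalue (tri A B c) + ereal \<epsilon>" .
qed

text \<open>The previous inequality, applied to \<open>c\<close> and to its reflection, gives both
  directions once lower and upper eigenvalues are identified.\<close>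

lemma eigenvalue_reflect:
  assumes "A > 0" "B > 0" "almost_periodic c"
  shows "upper_eigenvalue (tri A B (\<lambda>i. c (- i))) = upper_eigenvalue (tri A B c)"
proof (rule antisym)
  note refl = almost_periodic_reflect[OF assms(3)]
  show "upper_eigenvalue (tri A B (\<lambda>i. c (- i))) \<le> upper_eigenvalue (tri A B c)"
    using upper_le_lower_eigenvalue_reflect[OF assms]
    unfolding lower_eq_upper_eigenvalue[OF assms] .
  show "upper_eigenvalue (tri A B c) \<le> upper_eigenvalue (tri A B (\<lambda>i. c (- i)))"
    using upper_le_lower_eigenvalue_reflect[OF assms(1,2) refl]
    unfolding lower_eq_upper_eigenvalue[OF assms(1,2) refl] minus_minus .
qed

section \<open>Reduction of the original operators\<close>

lemma exp_shift:
  fixes p :: real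
  shows "exp (- p * of_int i) * (exp (p * of_int j) * x) = exp (p * of_int (j - i)) * x"
proof -
  have "exp (- p * of_int i) * exp (p * of_int j) = exp (p * of_int (j - i))"
    by (simp add: exp_add[symmetric] algebra_simps)
  then show ?thesis by (simp only: mult.assoc[symmetric])
qed

text \<open>Conjugation multiplies the two neighbours by \<open>exp p\<close> and
  \<open>exp (- p)\<close>; \<open>- 2 * d\<close> is the diagonal of the discrete Laplacian,
  written as an added constant so that almost periodicity visibly persists.\<close>

lemma exp_conj_op_L:
  "exp_conj p (op_L (\<lambda>_. d) (\<lambda>_. d) a) = tri (d * exp p) (d * exp (- p)) (\<lambda>i. a i + - 2 * d)"
proof (intro ext)
  fix \<phi> i
  have "exp_conj p (op_L (\<lambda>_. d) (\<lambda>_. d) a) \<phi> i =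
      d * (exp (- p * of_int i) * (exp (p * of_int (i + 1)) * \<phi> (i + 1)))
      + d * (exp (- p * of_int i) * (exp (p * of_int (i - 1)) * \<phi> (i - 1)))
      + (a i - 2 * d) * (exp (- p * of_int i) * (exp (p * of_int i) * \<phi> i))"
    unfolding exp_conj_def op_L_def by (simp add: algebra_simps del: of_int_add of_int_diff)
  then show "exp_conj p (op_L (\<lambda>_. d) (\<lambda>_. d) a) \<phi> i =
      tri (d * exp p) (d * exp (- p)) (\<lambda>i. a i + - 2 * d) \<phi> i"
    unfolding exp_shift tri_def by (simp add: algebra_simps)
qed

text \<open>With constant and equal diffusion rates, reflection acts on the zeroth-order coefficient
  alone.\<close>

lemma op_L_refl_const: "op_L_refl (\<lambda>_. d) (\<lambda>_. d) a = op_L (\<lambda>_. d) (\<lambda>_. d) (\<lambda>i. a (- i))"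
  by (simp add: op_L_refl_def op_L_def fun_eq_iff)

theorem theorem5p2:
  fixes f :: "int \<Rightarrow> real \<Rightarrow> real" and d' d :: "int \<Rightarrow> real" and \<gamma> d0 :: real
  assumes f_ends: "\<And>i. f i 0 = 0 \<and> f i 1 = 0"
    and f_KPP: "\<And>i s. 0 < s \<Longrightarrow> s < 1 \<Longrightarrow>
        0 < (INF j. ereal (f j s)) \<and> (INF j. ereal (f j s)) \<le> ereal (f i s) \<and> f i s \<le> slope0 f i * s"
    and \<gamma>: "0 < \<gamma>" "\<gamma> \<le> 1"
    and f_Hoelder: "(SUP i. C1_Hoelder_norm \<gamma> (f i)) < \<infinity>"
    and liminf: "Liminf abs_at_top (\<lambda>i. ereal (slope0 f i - (sqrt (d' i) - sqrt (d i))\<^sup>2)) > 0"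
    and d0: "d0 > 0"
    and d_const: "\<And>i. d' i = d0 \<and> d i = d0"
    and ap: "almost_periodic (slope0 f)"
  shows "\<forall>p :: real.
      lower_eigenvalue (exp_conj p (op_L d' d (slope0 f))) = upper_eigenvalue (exp_conj p (op_L d' d (slope0 f))) \<and>
      upper_eigenvalue (exp_conj p (op_L d' d (slope0 f))) = lower_eigenvalue (exp_conj p (op_L_refl d' d (slope0 f))) \<and>
      lower_eigenvalue (exp_conj p (op_L_refl d' d (slope0 f))) = upper_eigenvalue (exp_conj p (op_L_refl d' d (slope0 f)))"
proof
  fix p :: real
  have d: "d' = (\<lambda>_. d0)" "d = (\<lambda>_. d0)" using d_const by auto
  define c where "c i = slope0 f i + - 2 * d0" for i
  have c: "almost_periodic c" unfolding c_def by (rule almost_periodic_add_const[OF ap])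
  have AB: "d0 * exp p > 0" "d0 * exp (- p) > 0" using d0 by simp_all
  show "lower_eigenvalue (exp_conj p (op_L d' d (slope0 f))) = upper_eigenvalue (exp_conj p (op_L d' d (slope0 f))) \<and>
      upper_eigenvalue (exp_conj p (op_L d' d (slope0 f))) = lower_eigenvalue (exp_conj p (op_L_refl d' d (slope0 f))) \<and>
      lower_eigenvalue (exp_conj p (op_L_refl d' d (slope0 f))) = upper_eigenvalue (exp_conj p (op_L_refl d' d (slope0 f)))"
    using lower_eq_upper_eigenvalue[OF AB c] eigenvalue_reflect[OF AB c]
      lower_eq_upper_eigenvalue[OF AB almost_periodic_reflect[OF c]]
    unfolding d op_L_refl_const exp_conj_op_L c_def by simp
qed

end
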